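(* For every formula $\phi$ of the language $\phi ::= p \mid \bot \mid \phi\to\phi \mid K_a\phi$ ($a\in A$): if $\phi$ is a theorem of the multi-agent modal logic $S5$ (i.e. derivable in the Hilbert system described in the context), then $\phi$ is valid in the base-extension semantics for $S5$, i.e. $\Vdash_{\mathscr{B},\mathfrak{R}_A}\phi$ for every base $\mathscr{B}$ and every family $\mathfrak{R}_A=(\mathfrak{R}_a)_{a\in A}$ of $S5$-modal relations.
   Context: Fix a countably infinite set of atomic formulae and a nonempty set $A$ of agents. Formulae: $\phi ::= p \mid \bot \mid \phi\to\phi \mid K_a\phi$ with $p$ atomic and $a\in A$; $\neg\phi$ abbreviates $\phi\to\bot$. Hilbert system for multi-agent $S5$: axioms, for all formulae $\phi,\psi,\chi$ and all $a\in A$: (1) $\phi\to(\psi\to\phi)$; (2) $(\phi\to(\psi\to\chi))\to((\phi\to\psi)\to(\phi\to\chi))$; (3) $(\neg\phi\to\neg\psi)\to(\psi\to\phi)$; (K) $K_a(\phi\to\psi)\to(K_a\phi\to K_a\psi)$; (T) $K_a\phi\to\phi$; (4) $K_a\phi\to K_aK_a\phi$; (5) $\neg K_a\phi\to K_a\neg K_a\phi$; rules (MP) from $\phi$ and $\phi\to\psi$ infer $\psi$; (NEC) from $\phi$ infer $K_a\phi$. A theorem is a formula derivable in this system. A base rule is written $p_1,\dots,p_n\Rightarrow p$, where $\{p_1,\dots,p_n\}$ is a finite (possibly empty) set of atoms and $p$ is an atom. A base is a countable set of base rules; $\Omega$ is the set of all bases. $\overline{\mathscr{B}}$ is the smallest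 set of atoms closed under the rules of $\mathscr{B}$ (whenever all premises of a rule are in it, so is its conclusion). A base $\mathscr{B}$ is inconsistent iff every atom lies in $\overline{\mathscr{B}}$, and consistent otherwise. An $S5$-modal relation is a binary relation $\mathfrak{R}$ on $\Omega$ that is reflexive, transitive and Euclidean (if $\mathfrak{R}\mathscr{B}\mathscr{C}$ and $\mathfrak{R}\mathscr{B}\mathscr{D}$ then $\mathfrak{R}\mathscr{C}\mathscr{D}$) and satisfies, for all bases $\mathscr{B}$: (a) if $\mathscr{B}$ is inconsistent, there is an inconsistent $\mathscr{C}$ with $\mathfrak{R}\mathscr{B}\mathscr{C}$, and every $\mathscr{D}$ with $\mathfrak{R}\mathscr{B}\mathscr{D}$ is inconsistent; (b) if $\mathscr{B}$ is consistent, every $\mathscr{C}$ with $\mathfrak{R}\mathscr{B}\mathscr{C}$ is consistent; (c) for all $\mathscr{C}$, if $\mathfrak{R}\mathscr{B}\mathscr{C}$ then for every consistent $\mathscr{D}\supseteq\mathscr{B}$ there is $\mathscr{E}\supseteq\mathscr{C}$ with $\mathfrak{R}\mathscr{D}\mathscr{E}$; (d) for all consistent $\mathscr{C}$, if $\mathfrak{R}\mathscr{B}\mathscr{C}$ then for every $\mathscr{D}\subseteq\mathscr{B}$ there is $\mathscr{E}\subseteq\mathscr{C}$ with $\mathfrak{R}\mathscr{D}\mathscr{E}$. For a family $\mathfrak{R}_A=(\mathfrak{R}_a)_{a\in A}$ of $S5$-modal relations, validity at a base is defined inductively: $\Vdash_{\mathscr{B},\mathfrak{R}_A}p$ iff $p\in\overline{\mathscr{B}}$;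 $\Vdash_{\mathscr{B},\mathfrak{R}_A}\phi\to\psi$ iff $\phi\Vdash_{\mathscr{B},\mathfrak{R}_A}\psi$; $\Vdash_{\mathscr{B},\mathfrak{R}_A}\bot$ iff $\Vdash_{\mathscr{B},\mathfrak{R}_A}p$ for every atom $p$; $\Vdash_{\mathscr{B},\mathfrak{R}_A}K_a\phi$ iff $\Vdash_{\mathscr{C},\mathfrak{R}_A}\phi$ for all $\mathscr{C}$ with $\mathfrak{R}_a\mathscr{B}\mathscr{C}$; and for a nonempty set $\Gamma$ of formulae, $\Gamma\Vdash_{\mathscr{B},\mathfrak{R}_A}\phi$ iff for every $\mathscr{C}\supseteq\mathscr{B}$, if $\Vdash_{\mathscr{C},\mathfrak{R}_A}\psi$ for all $\psi\in\Gamma$ then $\Vdash_{\mathscr{C},\mathfrak{R}_A}\phi$. *)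

theory Defs
  imports Main "HOL-Library.FSet" "HOL-Library.Countable_Set"
begin

text \<open>The type variable \<open>'p\<close> is the set of atoms and \<open>'a\<close> the (nonempty) set of agents. That there
  are countably infinitely many atoms is an assumption of the theorem.\<close>

datatype ('p, 'a) form =
    Atom 'p
  | Falsum
  | Imp "('p, 'a) form" "('p, 'a) form"  (infixr "\<^bold>\<rightarrow>" 55)
  | Know 'a "('p, 'a) form"

abbreviation Neg :: "('p, 'a) form \<Rightarrow> ('p, 'a) form" where
  "Neg \<phi> \<equiv> \<phi> \<^bold>\<rightarrow> Falsum"

inductive S5_theorem :: "('p, 'a) form \<Rightarrow> bool" where
  Ax1: "S5_theorem (\<phi> \<^bold>\<rightarrow> (\<psi> \<^bold>\<rightarrow> \<phi>))"
| Ax2: "S5_theorem ((\<phi> \<^bold>\<rightarrow> (\<psi> \<^bold>\<rightarrow> \<chi>)) \<^bold>\<rightarrow> ((\<phi> \<^bold>\<rightarrow> \<psi>) \<^bold>\<rightarrow> (\<phi> \<^bold>\<rightarrow> \<chi>)))"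
| Ax3: "S5_theorem ((Neg \<phi> \<^bold>\<rightarrow> Neg \<psi>) \<^bold>\<rightarrow> (\<psi> \<^bold>\<rightarrow> \<phi>))"
| AxK: "S5_theorem (Know a (\<phi> \<^bold>\<rightarrow> \<psi>) \<^bold>\<rightarrow> (Know a \<phi> \<^bold>\<rightarrow> Know a \<psi>))"
| AxT: "S5_theorem (Know a \<phi> \<^bold>\<rightarrow> \<phi>)"
| Ax4: "S5_theorem (Know a \<phi> \<^bold>\<rightarrow> Know a (Know a \<phi>))"
| Ax5: "S5_theorem (Neg (Know a \<phi>) \<^bold>\<rightarrow> Know a (Neg (Know a \<phi>)))"
| MP: "S5_theorem \<phi> \<Longrightarrow> S5_theorem (\<phi> \<^bold>\<rightarrow> \<psi>) \<Longrightarrow> S5_theorem \<psi>"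
| NEC: "S5_theorem \<phi> \<Longrightarrow> S5_theorem (Know a \<phi>)"

text \<open>\<open>Rule {|p\<^sub>1, \<dots>, p\<^sub>n|} p\<close> is the base rule with premises \<open>p\<^sub>1, \<dots>, p\<^sub>n\<close> (possibly none) and
  conclusion \<open>p\<close>.\<close>

datatype 'p base_rule = Rule "'p fset" 'p

type_synonym 'p base = "'p base_rule set"

definition bases :: "'p base set" ("\<Omega>") where
  "\<Omega> = {B. countable B}"

inductive_set base_closure :: "'p base \<Rightarrow> 'p set" for B :: "'p base" where
  "\<lbrakk>Rule P p \<in> B; \<And>q. q |\<in>| P \<Longrightarrow> q \<in> base_closure B\<rbrakk> \<Longrightarrow> p \<in> base_closure B"

definition inconsistent :: "'p base \<Rightarrow> bool" where
  "inconsistent B \<longleftrightarrow> (\<forall>p. p \<in> base_closure B)"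

abbreviation consistent :: "'p base \<Rightarrow> bool" where
  "consistent B \<equiv> \<not> inconsistent B"

definition euclidean :: "'b rel \<Rightarrow> bool" where
  "euclidean r \<longleftrightarrow> (\<forall>x y z. (x, y) \<in> r \<longrightarrow> (x, z) \<in> r \<longrightarrow> (y, z) \<in> r)"

definition S5_modal_relation :: "'p base rel \<Rightarrow> bool" where
  "S5_modal_relation R \<longleftrightarrow>
     R \<subseteq> \<Omega> \<times> \<Omega> \<and> refl_on \<Omega> R \<and> trans R \<and> euclidean R \<and>
     (\<forall>B\<in>\<Omega>. inconsistent B \<longrightarrow>
        (\<exists>C\<in>\<Omega>. inconsistent C \<and> (B, C) \<in> R) \<and> (\<forall>D\<in>\<Omega>. (B, D) \<in> R \<longrightarrow> inconsistent D)) \<and>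
     (\<forall>B\<in>\<Omega>. consistent B \<longrightarrow> (\<forall>C\<in>\<Omega>. (B, C) \<in> R \<longrightarrow> consistent C)) \<and>
     (\<forall>B\<in>\<Omega>. \<forall>C\<in>\<Omega>. (B, C) \<in> R \<longrightarrow>
        (\<forall>D\<in>\<Omega>. consistent D \<and> B \<subseteq> D \<longrightarrow> (\<exists>E\<in>\<Omega>. C \<subseteq> E \<and> (D, E) \<in> R))) \<and>
     (\<forall>B\<in>\<Omega>. \<forall>C\<in>\<Omega>. consistent C \<and> (B, C) \<in> R \<longrightarrow>
        (\<forall>D\<in>\<Omega>. D \<subseteq> B \<longrightarrow> (\<exists>E\<in>\<Omega>. E \<subseteq> C \<and> (D, E) \<in> R)))"

text \<open>The clauses for \<open>Falsum\<close> and \<open>Imp\<close> are unfolded to make the recursion primitive: the former is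
  validity of every atom, the latter is \<open>{\<phi>} \<tturnstile> \<psi>\<close> at \<open>B\<close> in the sense of \<open>entails\<close>; see the two
  lemmas after \<open>entails\<close>.\<close>

primrec valid :: "('a \<Rightarrow> 'p base rel) \<Rightarrow> 'p base \<Rightarrow> ('p, 'a) form \<Rightarrow> bool" where
  "valid R B (Atom p) \<longleftrightarrow> p \<in> base_closure B"
| "valid R B Falsum \<longleftrightarrow> (\<forall>p. p \<in> base_closure B)"
| "valid R B (\<phi> \<^bold>\<rightarrow> \<psi>) \<longleftrightarrow> (\<forall>C\<in>\<Omega>. B \<subseteq> C \<longrightarrow> valid R C \<phi> \<longrightarrow> valid R C \<psi>)"
| "valid R B (Know a \<phi>) \<longleftrightarrow> (\<forall>C\<in>\<Omega>. (B, C) \<in> R a \<longrightarrow> valid R C \<phi>)"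

text \<open>Intended for nonempty \<open>\<Gamma>\<close>.\<close>

definition entails ::
  "('a \<Rightarrow> 'p base rel) \<Rightarrow> 'p base \<Rightarrow> ('p, 'a) form set \<Rightarrow> ('p, 'a) form \<Rightarrow> bool" where
  "entails R B \<Gamma> \<phi> \<longleftrightarrow> (\<forall>C\<in>\<Omega>. B \<subseteq> C \<longrightarrow> (\<forall>\<psi>\<in>\<Gamma>. valid R C \<psi>) \<longrightarrow> valid R C \<phi>)"

lemma valid_Falsum_iff: "valid R B Falsum \<longleftrightarrow> (\<forall>p. valid R B (Atom p))"
  by simp

lemma valid_Imp_iff: "valid R B (\<phi> \<^bold>\<rightarrow> \<psi>) \<longleftrightarrow> entails R B {\<phi>} \<psi>"
  by (simp add: entails_def)

end

theory Submission
  imports Defs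
begin

text \<open>Validity is monotone in the base: for \<open>K\<^sub>a\<close> this is condition (d), except that above
  an inconsistent base everything is valid anyway. The heart of the matter is that validity is closed
  under double negation elimination. For an atom \<open>p\<close> underivable in \<open>B\<close>, adding all rules
  \<open>p \<Rightarrow> q\<close> to \<open>B\<close> gives a base that refutes \<open>p\<close> but still does not derive it. For \<open>K\<^sub>a \<phi>\<close>,
  the relation is symmetric, so condition (c) moves consistent extensions back and forth between related bases:
  a consistent extension refuting \<open>\<phi>\<close> of some base related to \<open>B\<close> yields
  a consistent extension of \<open>B\<close> refuting \<open>K\<^sub>a \<phi>\<close>. The same use of condition (c) gives axiom (5).\<close>

section \<open>Derivability in bases\<close>

lemma base_closure_mono:
  assumes "p \<in> base_closure B" and "B \<subseteq> C"
  shows "p \<in> base_closure C"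
  using assms(1)
proof (induction rule: base_closure.induct)
  case (1 P p)
  show ?case by (rule base_closure.intros[of P]) (use 1 assms(2) in auto)
qed

lemma inconsistent_mono: "inconsistent B \<Longrightarrow> B \<subseteq> C \<Longrightarrow> inconsistent C"
  by (metis inconsistent_def base_closure_mono)

text \<open>Each added rule has \<open>p\<close> as its premise, and by the induction hypothesis
  that premise would already be derivable in \<open>B\<close>; so the added rules never
  fire.\<close>

lemma base_closure_explosion:
  assumes "r \<in> base_closure (B \<union> range (Rule {|p|}))" (is "_ \<in> base_closure ?C")
    and "p \<notin> base_closure B"
  shows "r \<in> base_closure B"
  using assms(1)
proof (induction rule: base_closure.induct)
  case (1 P r)
  have "Rule P r \<in> B"
  proof (rule ccontr)
    assume "Rule P r \<notin> B"
    with 1 have "p |\<in>| P" by auto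
    with 1 assms(2) show False by blast
  qed
  then show ?case by (rule base_closure.intros) (rule 1)
qed

lemma inconsistent_explosion:
  assumes "range (Rule {|p|}) \<subseteq> D" and "p \<in> base_closure D"
  shows "inconsistent D"
  unfolding inconsistent_def
proof
  fix q
  show "q \<in> base_closure D"
    by (rule base_closure.intros[of "{|p|}"]) (use assms in auto)
qed

text \<open>There is one added rule per atom, so countability of the atoms keeps the extension in
  \<open>\<Omega>\<close>.\<close>

lemma bases_explosion:
  assumes "countable (UNIV :: 'p set)" and "(B :: 'p base) \<in> \<Omega>"
  shows "B \<union> range (Rule {|p|}) \<in> \<Omega>"
  using assms by (simp add: bases_def)

lemma valid_Falsum: "valid R B Falsum \<longleftrightarrow> inconsistent B"
  by (simp add: inconsistent_def)

section \<open>Consequences of the conditions on a single S5-modal relation\<close>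

context
  fixes R :: "'p base rel"
  assumes S5: "S5_modal_relation R"
begin

lemma S5_refl: "B \<in> \<Omega> \<Longrightarrow> (B, B) \<in> R"
  using S5 by (simp add: S5_modal_relation_def refl_on_def)

lemma S5_bases: "(B, C) \<in> R \<Longrightarrow> B \<in> \<Omega> \<and> C \<in> \<Omega>"
  using S5 by (auto simp: S5_modal_relation_def)

lemma S5_trans: "(B, C) \<in> R \<Longrightarrow> (C, D) \<in> R \<Longrightarrow> (B, D) \<in> R"
proof -
  have "trans R" using S5 unfolding S5_modal_relation_def by (elim conjE)
  then show "(B, C) \<in> R \<Longrightarrow> (C, D) \<in> R \<Longrightarrow> (B, D) \<in> R" by (rule transD)
qed

lemma S5_sym:
  assumes "(B, C) \<in> R"
  shows "(C, B) \<in> R"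
proof -
  have "euclidean R" using S5 unfolding S5_modal_relation_def by (elim conjE)
  moreover have "(B, B) \<in> R" using S5_refl S5_bases[OF assms] by blast
  ultimately show ?thesis using assms unfolding euclidean_def by blast
qed

lemma S5_inconsistent: "(B, C) \<in> R \<Longrightarrow> inconsistent B \<Longrightarrow> inconsistent C"
proof -
  have "\<forall>B\<in>\<Omega>. inconsistent B \<longrightarrow> (\<forall>D\<in>\<Omega>. (B, D) \<in> R \<longrightarrow> inconsistent D)"
    using S5 unfolding S5_modal_relation_def by (elim conjE) meson
  then show "(B, C) \<in> R \<Longrightarrow> inconsistent B \<Longrightarrow> inconsistent C"
    using S5_bases[of B C] by meson
qed

text \<open>Contraposition of \<open>S5_inconsistent\<close>, read along the reversed pair.\<close>

lemma S5_consistent: "(B, C) \<in> R \<Longrightarrow> consistent B \<Longrightarrow> consistent C"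
  using S5_inconsistent[OF S5_sym] by auto

text \<open>Condition (c), with the consistency of \<open>D\<close> passed on to the witness so that
  the step can be repeated from there.\<close>

lemma S5_extend:
  assumes "(B, C) \<in> R" and "B \<subseteq> D" and "D \<in> \<Omega>" and "consistent D"
  obtains E where "E \<in> \<Omega>" and "C \<subseteq> E" and "(D, E) \<in> R" and "consistent E"
proof -
  have "\<forall>B\<in>\<Omega>. \<forall>C\<in>\<Omega>. (B, C) \<in> R \<longrightarrow>
        (\<forall>D\<in>\<Omega>. consistent D \<and> B \<subseteq> D \<longrightarrow> (\<exists>E\<in>\<Omega>. C \<subseteq> E \<and> (D, E) \<in> R))"
    using S5 unfolding S5_modal_relation_def by (elim conjE)
  with assms S5_bases[OF assms(1)] obtain E where E: "E \<in> \<Omega>" "C \<subseteq> E" "(D, E) \<in> R"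
    by meson
  then show thesis using S5_consistent[OF E(3) assms(4)] by (rule that)
qed

lemma S5_restrict:
  assumes "(B, C) \<in> R" and "D \<subseteq> B" and "D \<in> \<Omega>" and "consistent C"
  obtains E where "E \<in> \<Omega>" and "E \<subseteq> C" and "(D, E) \<in> R"
proof -
  have "\<forall>B\<in>\<Omega>. \<forall>C\<in>\<Omega>. consistent C \<and> (B, C) \<in> R \<longrightarrow>
        (\<forall>D\<in>\<Omega>. D \<subseteq> B \<longrightarrow> (\<exists>E\<in>\<Omega>. E \<subseteq> C \<and> (D, E) \<in> R))"
    using S5 unfolding S5_modal_relation_def by (elim conjE)
  with assms S5_bases[OF assms(1)] obtain E where "E \<in> \<Omega>" "E \<subseteq> C" "(D, E) \<in> R"
    by meson
  then show thesis by (rule that)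
qed

end

section \<open>Validity over a family of S5-modal relations\<close>

context
  fixes R :: "'a \<Rightarrow> 'p base rel"
  assumes S5: "\<And>a. S5_modal_relation (R a)"
begin

text \<open>Inconsistency passes to extensions and to related bases, the only bases that the clauses
  for implication and \<open>Know\<close> inspect.\<close>

lemma valid_inconsistent: "inconsistent B \<Longrightarrow> valid R B \<phi>"
proof (induction \<phi> arbitrary: B)
  case (Imp \<phi> \<psi>)
  then show ?case using inconsistent_mono by auto
next
  case (Know a \<phi>)
  then show ?case using S5_inconsistent[OF S5] by auto
qed (auto simp: inconsistent_def)

lemma valid_mono:
  assumes "valid R B \<phi>" and "B \<subseteq> C" and "B \<in> \<Omega>"
  shows "valid R C \<phi>"
  using assms
proof (induction \<phi> arbitrary: B C)
  case (Atom p)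
  then show ?case using base_closure_mono by auto
next
  case Falsum
  then show ?case using inconsistent_mono by (simp only: valid_Falsum)
next
  case (Imp \<phi> \<psi>)
  then show ?case by (auto dest: order_trans)
next
  case (Know a \<phi>)
  have "valid R E \<phi>" if "(C, E) \<in> R a" for E
  proof (cases "inconsistent E")
    case False
    with S5_restrict[OF S5 that Know.prems(2,3)] obtain E'
      where "E' \<in> \<Omega>" "E' \<subseteq> E" "(B, E') \<in> R a" by blast
    with Know show ?thesis by auto
  qed (rule valid_inconsistent)
  then show ?case by simp
qed

lemma valid_Neg: "valid R B (Neg \<phi>) \<longleftrightarrow> (\<forall>C\<in>\<Omega>. B \<subseteq> C \<longrightarrow> valid R C \<phi> \<longrightarrow> inconsistent C)"
  by (simp add: inconsistent_def)

lemma valid_Neg_D: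
  "valid R B (Neg \<phi>) \<Longrightarrow> B \<subseteq> C \<Longrightarrow> C \<in> \<Omega> \<Longrightarrow> valid R C \<phi> \<Longrightarrow> inconsistent C"
  unfolding valid_Neg by blast

lemma valid_Know_transfer:
  assumes "valid R B (Know a \<phi>)" and "(B, C) \<in> R a"
  shows "valid R C (Know a \<phi>)"
  using assms S5_trans[OF S5] by auto

lemma valid_double_negation:
  assumes "countable (UNIV :: 'p set)" and "valid R B (Neg (Neg \<phi>))" and "B \<in> \<Omega>"
  shows "valid R B \<phi>"
  using assms(2,3)
proof (induction \<phi> arbitrary: B)
  case (Atom p)
  let ?C = "B \<union> range (Rule {|p|})"
  have C: "?C \<in> \<Omega>" using bases_explosion[OF assms(1) Atom.prems(2)] .
  \<comment> \<open>Any extension of \<open>?C\<close> that derives \<open>p\<close> derives every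
    atom by the added rules.\<close>
  have "valid R ?C (Neg (Atom p))"
    unfolding valid_Neg using inconsistent_explosion[of p] by simp
  with valid_Neg_D[OF Atom.prems(1) _ C] have "inconsistent ?C" by blast
  then have "p \<in> base_closure ?C" by (simp add: inconsistent_def)
  then show ?case using base_closure_explosion[of p B p] by auto
next
  case Falsum
  have "valid R B (Neg Falsum)" by simp
  with valid_Neg_D[OF Falsum.prems(1) _ Falsum.prems(2)] show ?case
    by (simp only: valid_Falsum)
next
  case (Imp \<phi> \<psi>)
  have "valid R C \<psi>" if C: "C \<in> \<Omega>" "B \<subseteq> C" "valid R C \<phi>" for C
  proof (rule Imp.IH(2)[OF _ C(1)])
    \<comment> \<open>Since \<open>\<phi>\<close> persists from \<open>C\<close>, a base above
      \<open>D\<close> validating the implication would validate \<open>\<psi>\<close> as well;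
      hence \<open>D\<close> refutes the implication, against the double negation at
      \<open>B\<close>.\<close>
    have "inconsistent D" if D: "D \<in> \<Omega>" "C \<subseteq> D" "valid R D (Neg \<psi>)" for D
    proof (rule valid_Neg_D[OF Imp.prems(1) _ D(1)])
      show "B \<subseteq> D" using C D by blast
      have "inconsistent E" if E: "E \<in> \<Omega>" "D \<subseteq> E" "valid R E (\<phi> \<^bold>\<rightarrow> \<psi>)" for E
      proof (rule valid_Neg_D[OF D(3) E(2,1)])
        have "valid R E \<phi>" using valid_mono[OF C(3) _ C(1)] D(2) E(2) by blast
        then show "valid R E \<psi>" using E by auto
      qed
      then show "valid R D (Neg (\<phi> \<^bold>\<rightarrow> \<psi>))" unfolding valid_Neg by blast
    qed
    then show "valid R C (Neg (Neg \<psi>))" unfolding valid_Neg[of _ "Neg \<psi>"] by blast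
  qed
  then show ?case by simp
next
  case (Know a \<phi>)
  have "valid R C \<phi>" if C: "C \<in> \<Omega>" "(B, C) \<in> R a" for C
  proof (rule Know.IH[OF _ C(1)])
    have "inconsistent D" if D: "D \<in> \<Omega>" "C \<subseteq> D" "valid R D (Neg \<phi>)" for D
    proof (rule ccontr)
      assume "consistent D"
      \<comment> \<open>First transfer: \<open>D\<close> lies above \<open>C\<close>, which is
        related to \<open>B\<close>, so some consistent \<open>E\<close> above \<open>B\<close> is
        related to \<open>D\<close>.\<close>
      with S5_extend[OF S5 S5_sym[OF S5 C(2)] D(2,1)] obtain E
        where E: "E \<in> \<Omega>" "B \<subseteq> E" "(D, E) \<in> R a" "consistent E" by blast
      have "inconsistent F" if F: "F \<in> \<Omega>" "E \<subseteq> F" "valid R F (Know a \<phi>)" for F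
      proof (rule ccontr)
        assume "consistent F"
        \<comment> \<open>Second transfer, back from \<open>F\<close> above \<open>E\<close> to
          \<open>G\<close> above \<open>D\<close>: \<open>G\<close> validates \<open>\<phi>\<close>,
          which \<open>D\<close> refutes.\<close>
        with S5_extend[OF S5 S5_sym[OF S5 E(3)] F(2,1)] obtain G
          where G: "G \<in> \<Omega>" "D \<subseteq> G" "(F, G) \<in> R a" "consistent G" by blast
        moreover from F(3) G have "valid R G \<phi>" by simp
        ultimately show False using valid_Neg_D[OF D(3)] by blast
      qed
      then have "valid R E (Neg (Know a \<phi>))" unfolding valid_Neg by blast
      with valid_Neg_D[OF Know.prems(1) E(2,1)] E(4) show False by blast
    qed
    then show "valid R C (Neg (Neg \<phi>))" unfolding valid_Neg[of _ "Neg \<phi>"] by blast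
  qed
  then show ?case by simp
qed

text \<open>By double negation elimination it suffices that any further extension refuting
  \<open>\<phi>\<close> is inconsistent, and there both \<open>\<psi>\<close> and its negation
  hold.\<close>

lemma valid_Ax3:
  assumes "countable (UNIV :: 'p set)"
  shows "valid R B ((Neg \<phi> \<^bold>\<rightarrow> Neg \<psi>) \<^bold>\<rightarrow> (\<psi> \<^bold>\<rightarrow> \<phi>))"
proof -
  have "valid R D \<phi>"
    if C: "C \<in> \<Omega>" "valid R C (Neg \<phi> \<^bold>\<rightarrow> Neg \<psi>)" and D: "D \<in> \<Omega>" "C \<subseteq> D" "valid R D \<psi>" for C D
  proof (rule valid_double_negation[OF assms _ D(1)])
    have "inconsistent E" if E: "E \<in> \<Omega>" "D \<subseteq> E" "valid R E (Neg \<phi>)" for E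
    proof (rule valid_Neg_D[OF _ order_refl E(1)])
      have "C \<subseteq> E" using D E by blast
      with C(2) E show "valid R E (Neg \<psi>)"
        unfolding valid.simps(3)[of _ _ "Neg \<phi>"] by blast
      show "valid R E \<psi>" using valid_mono[OF D(3) E(2) D(1)] .
    qed
    then show "valid R D (Neg (Neg \<phi>))" unfolding valid_Neg[of _ "Neg \<phi>"] by blast
  qed
  then show ?thesis
    \<comment> \<open>The instances unfold only the outer implications and leave the antecedent
      intact.\<close>
    unfolding valid.simps(3)[of _ _ "Neg \<phi> \<^bold>\<rightarrow> Neg \<psi>"] valid.simps(3)[of _ _ \<psi>] by blast
qed

lemma valid_Ax5: "valid R B (Neg (Know a \<phi>) \<^bold>\<rightarrow> Know a (Neg (Know a \<phi>)))"
proof -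
  have "inconsistent E"
    if C: "valid R C (Neg (Know a \<phi>))" and D: "(C, D) \<in> R a"
      and E: "E \<in> \<Omega>" "D \<subseteq> E" "valid R E (Know a \<phi>)" for C D E
  proof (rule ccontr)
    assume "consistent E"
    \<comment> \<open>\<open>F\<close> lies above \<open>C\<close> and inherits
      \<open>Know a \<phi>\<close> from the related \<open>E\<close>, which \<open>C\<close>
      refutes.\<close>
    with S5_extend[OF S5 S5_sym[OF S5 D] E(2,1)] obtain F
      where "F \<in> \<Omega>" "C \<subseteq> F" "(E, F) \<in> R a" "consistent F" by blast
    with valid_Neg_D[OF C] valid_Know_transfer[OF E(3)] show False by blast
  qed
  then show ?thesis
    unfolding valid.simps(3)[of _ _ "Neg (Know a \<phi>)"] valid.simps(4)[of _ _ a "Neg (Know a \<phi>)"]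
      valid_Neg by blast
qed

text \<open>The induction keeps \<open>B\<close> arbitrary because \<open>NEC\<close> needs its
  premise valid at all related bases.\<close>

lemma soundness:
  assumes "countable (UNIV :: 'p set)" and "S5_theorem \<phi>" and "B \<in> \<Omega>"
  shows "valid R B \<phi>"
  using assms(2,3)
proof (induction arbitrary: B rule: S5_theorem.induct)
  case (Ax1 \<phi> \<psi>)
  then show ?case using valid_mono by auto
next
  case (Ax2 \<phi> \<psi> \<chi>)
  have "valid R E \<chi>"
    if "valid R C (\<phi> \<^bold>\<rightarrow> (\<psi> \<^bold>\<rightarrow> \<chi>))" "valid R D (\<phi> \<^bold>\<rightarrow> \<psi>)" "C \<subseteq> D"
      "E \<in> \<Omega>" "D \<subseteq> E" "valid R E \<phi>" for C D E
  proof -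
    have "C \<subseteq> E" using that by blast
    then have "valid R E (\<psi> \<^bold>\<rightarrow> \<chi>)" using that unfolding valid.simps(3)[of _ _ \<phi>] by blast
    moreover have "valid R E \<psi>" using that by auto
    ultimately show ?thesis using that(4) by simp
  qed
  then show ?case
    unfolding valid.simps(3)[of _ _ "\<phi> \<^bold>\<rightarrow> \<psi> \<^bold>\<rightarrow> \<chi>"] valid.simps(3)[of _ _ "\<phi> \<^bold>\<rightarrow> \<psi>"]
      valid.simps(3)[of _ _ \<phi> \<chi>] by blast
next
  case (Ax3 \<phi> \<psi>)
  show ?case by (rule valid_Ax3[OF assms(1)])
next
  case (AxK a \<phi> \<psi>)
  have "valid R E \<psi>"
    if "C \<in> \<Omega>" "valid R C (Know a (\<phi> \<^bold>\<rightarrow> \<psi>))" "C \<subseteq> D" "valid R D (Know a \<phi>)" "E \<in> \<Omega>" "(D, E) \<in> R a"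
    for C D E
    \<comment> \<open>Monotonicity lifts the known implication from \<open>C\<close> to
      \<open>D\<close>, so it meets \<open>\<phi>\<close> at \<open>E\<close>.\<close>
    using valid_mono[OF that(2,3,1)] that by auto
  then show ?case
    unfolding valid.simps(3)[of _ _ "Know a _"] valid.simps(4)[of _ _ a \<psi>] by blast
next
  case (AxT a \<phi>)
  then show ?case using S5_refl[OF S5] by simp
next
  case (Ax4 a \<phi>)
  have "valid R D (Know a \<phi>)" if "valid R C (Know a \<phi>)" "(C, D) \<in> R a" for C D
    using valid_Know_transfer[OF that] .
  then show ?case
    unfolding valid.simps(3) valid.simps(4)[of _ _ a "Know a \<phi>"] by blast
next
  case (Ax5 a \<phi>)
  show ?case by (rule valid_Ax5)
next
  case (MP \<phi> \<psi>)
  then show ?case by auto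
next
  case (NEC \<phi> a)
  then show ?case by simp
qed

end

theorem theorem5p3:
  fixes \<phi> :: "('p, 'a) form"
    and R :: "'a \<Rightarrow> 'p base rel"
    and B :: "'p base"
  assumes "countable (UNIV :: 'p set)" and "infinite (UNIV :: 'p set)"
    and "S5_theorem \<phi>"
    and "B \<in> \<Omega>"
    and "\<And>a. S5_modal_relation (R a)"
  shows "valid R B \<phi>"
  using soundness[OF assms(5,1,3,4)] .

end
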